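(* Let $\mathbf{A}\in\mathbb{C}^{n\times n}$ with $\operatorname{Ind}\mathbf{A}=k$ and $\operatorname{rank}\mathbf{A}^{k+1}=\operatorname{rank}\mathbf{A}^{k}=r$, where $1\le r\le n$. Then the Drazin inverse $\mathbf{A}^{D}=(a^{D}_{ij})\in\mathbb{C}^{n\times n}$ has the determinantal representation $$a^{D}_{ij}=\frac{\sum_{\alpha\in I_{r,n}\{j\}}\left|\left(\mathbf{A}^{k+1}_{j.}\left(\mathbf{a}^{(k)}_{i.}\right)\right)^{\alpha}_{\alpha}\right|}{\sum_{\alpha\in I_{r,n}}\left|\left(\mathbf{A}^{k+1}\right)^{\alpha}_{\alpha}\right|}$$ for all $i,j=1,\dots,n$.
   Context: For $\mathbf{A}\in\mathbb{C}^{n\times n}$, the index $\operatorname{Ind}\mathbf{A}$ is the smallest nonnegative integer $k$ with $\operatorname{rank}\mathbf{A}^{k+1}=\operatorname{rank}\mathbf{A}^{k}$. The Drazin inverse $\mathbf{A}^{D}$ of a matrix with $\operatorname{Ind}\mathbf A=k$ is the unique matrix $\mathbf{X}$ satisfying $\mathbf{A}^{k+1}\mathbf{X}=\mathbf{A}^{k}$, $\mathbf{X}\mathbf{A}\mathbf{X}=\mathbf{X}$, $\mathbf{A}\mathbf{X}=\mathbf{X}\mathbf{A}$. Notation: $\mathbf{a}^{(k)}_{i.}$ is the $i$th row of $\mathbf{A}^{k}$. For a matrix $\mathbf{M}$ and a row vector $\mathbf{b}$, $\mathbf{M}_{j.}(\mathbf{b})$ is the matrix obtained from $\mathbf{M}$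 by replacing its $j$th row with $\mathbf{b}$; $\mathbf{A}^{k+1}_{j.}(\mathbf{b})$ means $(\mathbf{A}^{k+1})_{j.}(\mathbf{b})$. $|\mathbf{M}^{\alpha}_{\alpha}|$ is the principal minor of $\mathbf{M}$ with rows and columns indexed by $\alpha$. For $1\le r\le n$, $I_{r,n}$ is the set of all strictly increasing sequences of $r$ integers from $\{1,\dots,n\}$ (equivalently, $r$-element subsets), and $I_{r,n}\{j\}=\{\alpha\in I_{r,n}: j\in\alpha\}$. *)

theory Defs
  imports
    Complex_Main
    "Jordan_Normal_Form.Determinant"
    "Jordan_Normal_Form.DL_Rank"
    "Jordan_Normal_Form.DL_Submatrix"
begin

text \<open>Rows, columns and index sets are numbered from 0, as in the matrix library:
  the index range 1, ..., n of the literature is \<open>{..<n}\<close> here.\<close>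

text \<open>The first argument of \<^const>\<open>vec_space.rank\<close> is the number of rows.\<close>

definition mat_rank :: "'a::field mat \<Rightarrow> nat" where
  "mat_rank A = vec_space.rank (dim_row A) A"

definition mat_index :: "'a::field mat \<Rightarrow> nat" where
  "mat_index A = (LEAST k. mat_rank (A ^\<^sub>m (k + 1)) = mat_rank (A ^\<^sub>m k))"

definition is_drazin_inverse :: "'a::field mat \<Rightarrow> 'a mat \<Rightarrow> bool" where
  "is_drazin_inverse A X \<longleftrightarrow>
     X \<in> carrier_mat (dim_row A) (dim_row A) \<and>
     A ^\<^sub>m (mat_index A + 1) * X = A ^\<^sub>m mat_index A \<and>
     X * A * X = X \<and>
     A * X = X * A"

definition drazin_inverse :: "'a::field mat \<Rightarrow> 'a mat" where
  "drazin_inverse A = (THE X. is_drazin_inverse A X)"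

definition replace_row :: "'a mat \<Rightarrow> nat \<Rightarrow> 'a vec \<Rightarrow> 'a mat" where
  "replace_row M j b = mat (dim_row M) (dim_col M) (\<lambda>(p, q). if p = j then b $ q else M $$ (p, q))"

definition principal_minor :: "'a::comm_ring_1 mat \<Rightarrow> nat set \<Rightarrow> 'a" where
  "principal_minor M \<alpha> = det (submatrix M \<alpha> \<alpha>)"

text \<open>A strictly increasing sequence of \<open>r\<close> indices below \<open>n\<close> is identified with its set of
  entries; \<^const>\<open>submatrix\<close> takes the rows and columns in increasing order.\<close>

definition index_sets :: "nat \<Rightarrow> nat \<Rightarrow> nat set set" where
  "index_sets r n = {\<alpha>. \<alpha> \<subseteq> {..<n} \<and> card \<alpha> = r}"

definition index_sets_at :: "nat \<Rightarrow> nat \<Rightarrow> nat \<Rightarrow> nat set set" where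
  "index_sets_at r n j = {\<alpha> \<in> index_sets r n. j \<in> \<alpha>}"

end

theory Submission
  imports
    Defs
    "Jordan_Normal_Form.Jordan_Normal_Form_Existence"
    "Jordan_Normal_Form.Jordan_Normal_Form_Uniqueness"
begin

text \<open>
  Put \<open>M = A\<^sup>k\<^sup>+\<^sup>1\<close>, let \<open>X\<close> be the Drazin inverse of \<open>A\<close>, and write
  \<open>det (\<lambda>I + M) = \<Sum>\<^sub>s c\<^sub>s \<lambda>\<^sup>s\<close> and \<open>adj (\<lambda>I + M) = \<Sum>\<^sub>s B\<^sub>s \<lambda>\<^sup>s\<close>. Expanding determinants in the
  entries \<open>\<lambda>\<close> of the diagonal identifies the denominator with \<open>c\<^sub>n\<^sub>-\<^sub>r\<close> and, row \<open>j\<close> carrying no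
  \<open>\<lambda>\<close>, the numerator with the \<open>(i, j)\<close> entry of \<open>A\<^sup>k B\<^sub>n\<^sub>-\<^sub>r\<close>. Since \<open>M\<close> and all its powers have the
  same kernel, \<open>0\<close> is a root of \<open>det (\<lambda>I + M)\<close> of multiplicity exactly \<open>n - r\<close>. Comparing
  coefficients in \<open>(\<lambda>I + M) adj (\<lambda>I + M) = det (\<lambda>I + M) I\<close> gives \<open>B\<^sub>s\<^sub>-\<^sub>1 + M B\<^sub>s = c\<^sub>s I\<close>, so that
  \<open>M\<^sup>s\<^sup>+\<^sup>1 B\<^sub>s = 0\<close> for \<open>s < n - r\<close>. As \<open>X\<close> is a left multiple of every power of \<open>M\<close>, it annihilates
  \<open>B\<^sub>n\<^sub>-\<^sub>r\<^sub>-\<^sub>1\<close>, and \<open>A\<^sup>k B\<^sub>n\<^sub>-\<^sub>r = X M B\<^sub>n\<^sub>-\<^sub>r = c\<^sub>n\<^sub>-\<^sub>r X\<close>.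
\<close>

subsection \<open>Determinants with a perturbed diagonal\<close>

lemma pick_bij_betw:
  assumes "finite I"
  shows "bij_betw (pick I) {..<card I} I"
proof -
  have inj: "inj_on (pick I) {..<card I}"
  proof (rule inj_onI)
    fix x y assume xy: "x \<in> {..<card I}" "y \<in> {..<card I}" "pick I x = pick I y"
    have "x = card {a \<in> I. a < pick I x}" using card_pick[of x I] xy by simp
    also have "\<dots> = y" unfolding xy(3) using card_pick[of y I] xy by simp
    finally show "x = y" .
  qed
  moreover have "pick I ` {..<card I} \<subseteq> I"
    by (auto intro: pick_in_set)
  ultimately show ?thesis
    unfolding bij_betw_def using card_subset_eq[OF assms] card_image[OF inj] by simp
qed

text \<open>Leibniz formula with permutations of \<alpha> itself in place of
  \<open>{0..<card \<alpha>}\<close>. This makes the minors for different \<alpha> comparable with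
  parts of one sum over the permutations of \<open>{..<n}\<close>.\<close>

lemma principal_minor_eq_sum_permutes:
  assumes M: "M \<in> carrier_mat n n" and \<alpha>: "\<alpha> \<subseteq> {..<n}"
  shows "principal_minor M \<alpha> = (\<Sum>p | p permutes \<alpha>. signof p * (\<Prod>i\<in>\<alpha>. M $$ (i, p i)))"
proof -
  define e where "e = pick \<alpha>"
  let ?r = "card \<alpha>"
  have fin: "finite \<alpha>" using \<alpha> finite_subset by blast
  have e: "bij_betw e {0..<?r} \<alpha>"
    unfolding e_def using pick_bij_betw[OF fin] by (simp add: atLeast0LessThan)
  have inj: "inj_on e {0..<?r}" using e by (simp add: bij_betw_def)
  \<comment> \<open>\<open>?g q\<close> is the conjugate of \<open>q\<close> by the increasing
    enumeration \<open>e\<close>, extended by the identity outside \<alpha>; conjugation preserves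
    the sign.\<close>
  let ?g = "\<lambda>q. map_permutation {0..<?r} e q"
  have sel: "{i. i < n \<and> i \<in> \<alpha>} = \<alpha>" using \<alpha> by auto
  hence sub: "submatrix M \<alpha> \<alpha> = mat ?r ?r (\<lambda>(i, j). M $$ (e i, e j))"
    using M by (simp add: submatrix_def e_def sel)
  have "principal_minor M \<alpha> = (\<Sum>q | q permutes {0..<?r}. signof q * (\<Prod>i = 0..<?r. M $$ (e i, e (q i))))"
    unfolding principal_minor_def sub
  proof (subst det_def'[of _ ?r], simp, rule sum.cong[OF refl])
    fix q assume "q \<in> {q. q permutes {0..<?r}}"
    hence "q i < ?r" if "i < ?r" for i using permutes_in_image[of q "{0..<?r}" i] that by simp
    thus "signof q * (\<Prod>i = 0..<?r. mat ?r ?r (\<lambda>(i, j). M $$ (e i, e j)) $$ (i, q i)) =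
        signof q * (\<Prod>i = 0..<?r. M $$ (e i, e (q i)))"
      by (intro arg_cong2[where f = "(*)"] prod.cong refl) auto
  qed
  also have "\<dots> = (\<Sum>q | q permutes {0..<?r}. signof (?g q) * (\<Prod>i\<in>\<alpha>. M $$ (i, ?g q i)))"
  proof (rule sum.cong)
    fix q assume "q \<in> {q. q permutes {0..<?r}}"
    hence q: "q permutes {0..<?r}" by simp
    have "(\<Prod>i\<in>\<alpha>. M $$ (i, ?g q i)) = (\<Prod>i = 0..<?r. M $$ (e i, ?g q (e i)))"
      by (rule prod.reindex_bij_betw[OF e, symmetric])
    also have "\<dots> = (\<Prod>i = 0..<?r. M $$ (e i, e (q i)))"
      by (simp add: map_permutation_apply[OF inj])
    finally show "signof q * (\<Prod>i = 0..<?r. M $$ (e i, e (q i))) =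
        signof (?g q) * (\<Prod>i\<in>\<alpha>. M $$ (i, ?g q i))"
      by (simp add: sign_map_permutation[OF inj q])
  qed simp
  also have "\<dots> = (\<Sum>p | p permutes \<alpha>. signof p * (\<Prod>i\<in>\<alpha>. M $$ (i, p i)))"
  proof (rule sum.reindex_bij_betw)
    let ?h = "map_permutation \<alpha> (inv_into {0..<?r} e)"
    have inv: "bij_betw (inv_into {0..<?r} e) \<alpha> {0..<?r}"
      using e by (rule bij_betw_inv_into)
    show "bij_betw ?g {q. q permutes {0..<?r}} {p. p permutes \<alpha>}"
    proof (rule bij_betwI[where g = ?h])
      show "?g \<in> {q. q permutes {0..<?r}} \<rightarrow> {p. p permutes \<alpha>}"
        using map_permutation_permutes[OF e] by auto
      show "?h \<in> {p. p permutes \<alpha>} \<rightarrow> {q. q permutes {0..<?r}}"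
        using map_permutation_permutes[OF inv] by auto
      show "?h (?g q) = q" if "q \<in> {q. q permutes {0..<?r}}" for q
        using that inj by (intro map_permutation_compose_inv[OF e]) auto
      show "?g (?h p) = p" if "p \<in> {p. p permutes \<alpha>}" for p
        using that e by (intro map_permutation_compose_inv[OF inv])
          (auto simp: bij_betw_def f_inv_into_f)
    qed
  qed
  finally show ?thesis .
qed

text \<open>Multiply out the products in the Leibniz formula: \<alpha> collects the rows in which
  the entry of \<open>M\<close> is chosen. The other rows contribute a diagonal entry, so only
  permutations fixing the complement of \<alpha> survive, and these are the permutations of
  \<alpha>.\<close>

lemma det_add_diag:
  fixes M :: "'a::comm_ring_1 mat"
  assumes M: "M \<in> carrier_mat n n"
  shows "det (mat n n (\<lambda>(i, j). M $$ (i, j) + (if i = j then d i else 0))) =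
    (\<Sum>\<alpha>\<in>Pow {..<n}. (\<Prod>i\<in>{..<n} - \<alpha>. d i) * principal_minor M \<alpha>)"
proof -
  let ?S = "{p. p permutes {..<n}}"
  let ?R = "\<lambda>p \<alpha>. \<Prod>i\<in>{..<n} - \<alpha>. if p i = i then d i else 0"
  have "det (mat n n (\<lambda>(i, j). M $$ (i, j) + (if i = j then d i else 0))) =
    (\<Sum>p\<in>?S. signof p * (\<Prod>i<n. M $$ (i, p i) + (if p i = i then d i else 0)))"
  proof (subst det_def'[of _ n], simp, unfold atLeast0LessThan, rule sum.cong[OF refl])
    fix p assume "p \<in> ?S"
    hence "p i < n" if "i < n" for i using permutes_in_image[of p "{..<n}" i] that by simp
    thus "signof p * (\<Prod>i<n. mat n n (\<lambda>(i, j). M $$ (i, j) + (if i = j then d i else 0)) $$ (i, p i)) =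
        signof p * (\<Prod>i<n. M $$ (i, p i) + (if p i = i then d i else 0))"
      by (intro arg_cong2[where f = "(*)"] prod.cong refl) auto
  qed
  also have "\<dots> = (\<Sum>p\<in>?S. \<Sum>\<alpha>\<in>Pow {..<n}. signof p * ((\<Prod>i\<in>\<alpha>. M $$ (i, p i)) * ?R p \<alpha>))"
    by (simp add: prod_add sum_distrib_left)
  also have "\<dots> = (\<Sum>\<alpha>\<in>Pow {..<n}. \<Sum>p\<in>?S. signof p * ((\<Prod>i\<in>\<alpha>. M $$ (i, p i)) * ?R p \<alpha>))"
    by (rule sum.swap)
  also have "\<dots> = (\<Sum>\<alpha>\<in>Pow {..<n}. (\<Prod>i\<in>{..<n} - \<alpha>. d i) * principal_minor M \<alpha>)"
  proof (rule sum.cong[OF refl])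
    fix \<alpha> assume "\<alpha> \<in> Pow {..<n}"
    hence \<alpha>: "\<alpha> \<subseteq> {..<n}" by simp
    have perm: "p permutes \<alpha>" if p: "p permutes {..<n}" and fx: "\<forall>i\<in>{..<n} - \<alpha>. p i = i" for p
      using permutes_superset[OF p] fx by auto
    \<comment> \<open>A permutation that moves a point outside \<alpha> has a zero factor in
      \<open>?R p \<alpha>\<close>.\<close>
    have "(\<Sum>p\<in>?S. signof p * ((\<Prod>i\<in>\<alpha>. M $$ (i, p i)) * ?R p \<alpha>)) =
      (\<Sum>p | p permutes \<alpha>. signof p * ((\<Prod>i\<in>\<alpha>. M $$ (i, p i)) * ?R p \<alpha>))"
    proof (rule sum.mono_neutral_right)
      show "finite ?S" by (simp add: finite_permutations)
      show "{p. p permutes \<alpha>} \<subseteq> ?S" using permutes_subset[OF _ \<alpha>] by auto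
      show "\<forall>p\<in>?S - {p. p permutes \<alpha>}. signof p * ((\<Prod>i\<in>\<alpha>. M $$ (i, p i)) * ?R p \<alpha>) = 0"
      proof
        fix p assume "p \<in> ?S - {p. p permutes \<alpha>}"
        then obtain i where "i \<in> {..<n} - \<alpha>" "p i \<noteq> i" using perm by blast
        hence "?R p \<alpha> = 0" by (intro prod_zero) auto
        thus "signof p * ((\<Prod>i\<in>\<alpha>. M $$ (i, p i)) * ?R p \<alpha>) = 0" by simp
      qed
    qed
    also have "\<dots> = (\<Sum>p | p permutes \<alpha>. (\<Prod>i\<in>{..<n} - \<alpha>. d i) * (signof p * (\<Prod>i\<in>\<alpha>. M $$ (i, p i))))"
    proof (rule sum.cong[OF refl])
      fix p assume "p \<in> {p. p permutes \<alpha>}"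
      hence "?R p \<alpha> = (\<Prod>i\<in>{..<n} - \<alpha>. d i)"
        by (intro prod.cong refl) (auto dest: permutes_not_in)
      thus "signof p * ((\<Prod>i\<in>\<alpha>. M $$ (i, p i)) * ?R p \<alpha>) =
          (\<Prod>i\<in>{..<n} - \<alpha>. d i) * (signof p * (\<Prod>i\<in>\<alpha>. M $$ (i, p i)))"
        by (simp add: mult_ac)
    qed
    also have "\<dots> = (\<Prod>i\<in>{..<n} - \<alpha>. d i) * principal_minor M \<alpha>"
      by (simp add: principal_minor_eq_sum_permutes[OF M \<alpha>] sum_distrib_left)
    finally show "(\<Sum>p\<in>?S. signof p * ((\<Prod>i\<in>\<alpha>. M $$ (i, p i)) * ?R p \<alpha>)) =
        (\<Prod>i\<in>{..<n} - \<alpha>. d i) * principal_minor M \<alpha>" .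
  qed
  finally show ?thesis .
qed

lemma submatrix_map_mat: "submatrix (map_mat f A) I J = map_mat f (submatrix A I J)"
  by (rule eq_matI) (auto simp: submatrix_def dim_submatrix pick_le)

lemma (in comm_ring_hom) principal_minor_hom:
  "principal_minor (map_mat hom M) \<alpha> = hom (principal_minor M \<alpha>)"
  by (simp add: principal_minor_def submatrix_map_mat)

text \<open>\<open>J\<close> marks the rows that carry the variable: \<open>UNIV\<close> gives the
  denominator of the representation, \<open>- {j}\<close> the numerator. A set \<alpha> contributes
  its minor in degree \<open>n - card \<alpha>\<close> if its complement lies in \<open>J\<close>,
  and nothing otherwise.\<close>

lemma coeff_det_add_var_diag:
  fixes M :: "'a::comm_ring_1 mat"
  assumes M: "M \<in> carrier_mat n n" and r: "r \<le> n"
  shows "coeff (det (mat n n (\<lambda>(a, b). [:M $$ (a, b):] + (if a = b then if a \<in> J then [:0, 1:] else 0 else 0)))) (n - r)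
    = (\<Sum>\<alpha> | \<alpha> \<in> index_sets r n \<and> {..<n} - J \<subseteq> \<alpha>. principal_minor M \<alpha>)"
proof -
  interpret C: comm_ring_hom "\<lambda>a::'a. [:a:]" by unfold_locales auto
  let ?d = "\<lambda>a. if a \<in> J then [:0, 1:] else 0 :: 'a poly"
  let ?M = "map_mat (\<lambda>a. [:a:]) M"
  have "mat n n (\<lambda>(a, b). [:M $$ (a, b):] + (if a = b then ?d a else 0)) =
    mat n n (\<lambda>(a, b). ?M $$ (a, b) + (if a = b then ?d a else 0))"
    using M by (intro eq_matI) auto
  hence "det (mat n n (\<lambda>(a, b). [:M $$ (a, b):] + (if a = b then ?d a else 0))) =
    (\<Sum>\<alpha>\<in>Pow {..<n}. (\<Prod>i\<in>{..<n} - \<alpha>. ?d i) * [:principal_minor M \<alpha>:])"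
    using det_add_diag[of ?M n ?d] M by (simp add: C.principal_minor_hom)
  also have "coeff \<dots> (n - r) =
    (\<Sum>\<alpha>\<in>Pow {..<n}. coeff ((\<Prod>i\<in>{..<n} - \<alpha>. ?d i) * [:principal_minor M \<alpha>:]) (n - r))"
    by (rule coeff_sum)
  also have "\<dots> = (\<Sum>\<alpha>\<in>Pow {..<n}. if \<alpha> \<in> index_sets r n \<and> {..<n} - J \<subseteq> \<alpha> then principal_minor M \<alpha> else 0)"
  proof (rule sum.cong[OF refl])
    fix \<alpha> assume "\<alpha> \<in> Pow {..<n}"
    hence \<alpha>: "\<alpha> \<subseteq> {..<n}" by simp
    hence card: "card ({..<n} - \<alpha>) = n - card \<alpha>" "card \<alpha> \<le> n"
      using card_Diff_subset[OF finite_subset[OF \<alpha>]] card_mono[OF _ \<alpha>] by auto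
    show "coeff ((\<Prod>i\<in>{..<n} - \<alpha>. ?d i) * [:principal_minor M \<alpha>:]) (n - r) =
      (if \<alpha> \<in> index_sets r n \<and> {..<n} - J \<subseteq> \<alpha> then principal_minor M \<alpha> else 0)"
    proof (cases "{..<n} - J \<subseteq> \<alpha>")
      case True
      hence "(\<Prod>i\<in>{..<n} - \<alpha>. ?d i) = (\<Prod>i\<in>{..<n} - \<alpha>. [:0, 1:])"
        by (intro prod.cong refl) auto
      also have "\<dots> = monom 1 (n - card \<alpha>)"
        by (simp add: card monom_altdef)
      finally have "coeff ((\<Prod>i\<in>{..<n} - \<alpha>. ?d i) * [:principal_minor M \<alpha>:]) (n - r) =
        (if n - card \<alpha> = n - r then principal_minor M \<alpha> else 0)"
        by (simp add: coeff_monom_mult coeff_pCons split: nat.split) 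
      \<comment> \<open>Both \<open>card \<alpha>\<close> and \<open>r\<close> are at most
        \<open>n\<close>, so the truncated differences agree only if
        \<open>card \<alpha> = r\<close>.\<close>
      thus ?thesis using True card r \<alpha> by (auto simp: index_sets_def)
    next
      case False
      then obtain i where "i \<in> {..<n} - \<alpha>" "i \<notin> J" by blast
      hence "(\<Prod>i\<in>{..<n} - \<alpha>. ?d i) = 0" by (intro prod_zero) auto
      with False show ?thesis by simp
    qed
  qed
  also have "\<dots> = (\<Sum>\<alpha> | \<alpha> \<in> Pow {..<n} \<and> \<alpha> \<in> index_sets r n \<and> {..<n} - J \<subseteq> \<alpha>. principal_minor M \<alpha>)"
    by (simp add: sum.If_cases Int_def)
  also have "{\<alpha>. \<alpha> \<in> Pow {..<n} \<and> \<alpha> \<in> index_sets r n \<and> {..<n} - J \<subseteq> \<alpha>} =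
      {\<alpha>. \<alpha> \<in> index_sets r n \<and> {..<n} - J \<subseteq> \<alpha>}"
    by (auto simp: index_sets_def)
  finally show ?thesis .
qed

subsection \<open>Rank, kernel and column space\<close>

context vectorspace
begin

lemma lin_indpt_subspace_iff:
  assumes "VectorSpace.subspace K W V" "S \<subseteq> W"
  shows "LinearCombinations.module.lin_dep K (vs W) S \<longleftrightarrow> lin_dep S"
  using span_li_not_depend(2)[OF assms(2)] assms(1) unfolding VectorSpace.subspace_def by auto

text \<open>Independent subsets of \<open>W\<close> are independent in \<open>V\<close>, so their
  size is bounded by \<open>dim\<close>; a maximal one exists and generates
  \<open>W\<close>.\<close>

lemma fin_dim_subspace:
  assumes W: "VectorSpace.subspace K W V" and fd: "fin_dim"
  shows "vectorspace.fin_dim K (vs W)"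
proof -
  interpret W: vectorspace K "vs W" by (rule subspace_is_vs[OF W])
  have WV: "W \<subseteq> carrier V" using W by (auto simp: VectorSpace.subspace_def submodule_def)
  let ?P = "\<lambda>S. S \<subseteq> carrier (vs W) \<and> W.lin_indpt S"
  have "W.lin_indpt {}" by (auto simp: W.lin_dep_def)
  hence "\<exists>S. finite S \<and> maximal S ?P"
    using WV li_le_dim[OF fd] lin_indpt_subspace_iff[OF W]
    by (intro maximal_exists[where B = "{}" and N = dim]) auto
  then obtain S where "finite S" "maximal S ?P" by blast
  thus ?thesis
    using W.max_li_is_gen[of S] unfolding W.fin_dim_def maximal_def by auto
qed

lemma subspace_eq_if_dim_eq:
  assumes W: "VectorSpace.subspace K W V" and fd: "fin_dim" and dim: "vectorspace.dim K (vs W) = dim"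
  shows "W = carrier V"
proof -
  interpret W: vectorspace K "vs W" by (rule subspace_is_vs[OF W])
  have WV: "W \<subseteq> carrier V" using W by (auto simp: VectorSpace.subspace_def submodule_def)
  obtain S where S: "finite S" "W.basis S"
    using W.finite_basis_exists[OF fin_dim_subspace[OF W fd]] by blast
  hence SW: "S \<subseteq> W" "W.lin_indpt S" "W.span S = W" by (auto simp: W.basis_def)
  have "card S = dim" using W.dim_basis[OF S] dim by simp
  moreover have "lin_indpt S" using lin_indpt_subspace_iff[OF W] SW by blast
  ultimately have "basis S" using S SW WV by (intro dim_li_is_basis[OF fd]) auto
  moreover have "W.span S = span S" 
    using span_li_not_depend(1)[OF SW(1)] W unfolding VectorSpace.subspace_def by auto
  ultimately show ?thesis using SW by (auto simp: basis_def)
qed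

lemma nested_subspaces_eq_if_dim_eq:
  assumes "VectorSpace.subspace K W V" "VectorSpace.subspace K U V" "U \<subseteq> W" "fin_dim"
    and "vectorspace.dim K (vs U) = vectorspace.dim K (vs W)"
  shows "U = W"
  using vectorspace.subspace_eq_if_dim_eq[OF subspace_is_vs[OF assms(1)] nested_subspaces[OF assms(1-3)]]
    fin_dim_subspace[OF assms(1,4)] assms(5) by auto

end

section \<open>Rank, kernel and column space of matrices\<close>

lemma rank_add_kernel_dim:
  fixes A :: "'a::field mat"
  assumes A: "A \<in> carrier_mat nr nc"
  shows "vec_space.rank nr A + kernel_dim A = nc"
proof -
  interpret kernel nr nc A by unfold_locales (rule A)
  interpret W: vec_space "TYPE('a)" nr .
  interpret T: linear_map class_ring NC.V W.V "\<lambda>v. A *\<^sub>v v"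
    using A by unfold_locales
      (auto simp: LinearCombinations.module_hom_def mult_add_distrib_mat_vec mult_mat_vec)
  have "T.imT = (\<lambda>v. A *\<^sub>v v) ` carrier_vec nc" by (simp add: T.im_def)
  also have "\<dots> = W.col_space A"
    unfolding W.col_space_eq[OF A] carrier_matD[OF A] using mult_mat_vec_carrier[OF A] by blast
  finally have "T.imT = W.span (set (cols A))" by (simp add: W.col_space_def)
  moreover have "T.kerT = mat_kernel A"
    using A unfolding T.ker_def mat_kernel_def by auto
  ultimately show ?thesis
    using T.rank_nullity[OF NC.fin_dim] by (simp add: W.rank_def NC.dim_is_n)
qed

lemma mat_kernel_eq_if_rank_eq:
  fixes A B :: "'a::field mat"
  assumes A: "A \<in> carrier_mat nr nc" and B: "B \<in> carrier_mat nr nc"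
    and sub: "mat_kernel A \<subseteq> mat_kernel B" and rank: "vec_space.rank nr A = vec_space.rank nr B"
  shows "mat_kernel A = mat_kernel B"
proof -
  interpret KA: kernel nr nc A by unfold_locales (rule A)
  interpret KB: kernel nr nc B by unfold_locales (rule B)
  have sp: "VectorSpace.subspace class_ring (mat_kernel C) KA.NC.V" if "C \<in> carrier_mat nr nc" for C :: "'a mat"
    unfolding VectorSpace.subspace_def using that
    by (auto intro!: KA.NC.vectorspace_axioms vectorspace.axioms(1)[OF KA.NC.vectorspace_axioms] simp: submodule_def mat_kernel_def mult_add_distrib_mat_vec mult_mat_vec)
  have "KA.dim = KB.dim"
    using rank_add_kernel_dim[OF A] rank_add_kernel_dim[OF B] rank by simp
  thus ?thesis
    using KA.NC.nested_subspaces_eq_if_dim_eq[OF sp[OF B] sp[OF A] sub KA.NC.fin_dim] by simp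
qed

lemma col_space_eq_if_rank_eq:
  fixes A B :: "'a::field mat"
  assumes A: "A \<in> carrier_mat n nc" and B: "B \<in> carrier_mat n nc'"
    and sub: "vec_space.col_space n A \<subseteq> vec_space.col_space n B"
    and rank: "vec_space.rank n A = vec_space.rank n B"
  shows "vec_space.col_space n A = vec_space.col_space n B"
proof -
  interpret vec_space "TYPE('a)" n .
  have sp: "VectorSpace.subspace class_ring (col_space C) V" if "C \<in> carrier_mat n m" for C m
    unfolding col_space_def using that by (intro span_is_subspace) (use cols_dim[of C] in auto)
  show ?thesis
    using nested_subspaces_eq_if_dim_eq[OF sp[OF B] sp[OF A] sub fin_dim] rank
    by (simp add: rank_def col_space_def)
qed

lemma col_space_mult_subset:
  fixes A B :: "'a::field mat"
  assumes A: "A \<in> carrier_mat n m" and B: "B \<in> carrier_mat m nc"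
  shows "vec_space.col_space n (A * B) \<subseteq> vec_space.col_space n A"
proof -
  have "\<exists>y\<in>carrier_vec m. A *\<^sub>v y = A * B *\<^sub>v x" if "x \<in> carrier_vec nc" for x
    using that A B by (intro bexI[of _ "B *\<^sub>v x"]) auto
  thus ?thesis
    using A B by (auto simp: vec_space.col_space_eq[OF A] vec_space.col_space_eq[OF mult_carrier_mat[OF A B]])
qed

text \<open>Each column of \<open>B\<close> has a preimage under \<open>A\<close>; these preimages
  are the columns of \<open>Y\<close>.\<close>

lemma mult_factor_if_col_space_subset:
  fixes A B :: "'a::field mat"
  assumes A: "A \<in> carrier_mat n m" and B: "B \<in> carrier_mat n nc"
    and sub: "vec_space.col_space n B \<subseteq> vec_space.col_space n A"
  obtains Y where "Y \<in> carrier_mat m nc" "B = A * Y"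
proof -
  have "\<exists>y\<in>carrier_vec m. A *\<^sub>v y = col B j" if j: "j < nc" for j
  proof -
    have "B *\<^sub>v unit_vec nc j = col B j" using B j by (intro eq_vecI) auto
    hence "col B j \<in> vec_space.col_space n B"
      using B j by (auto simp: vec_space.col_space_eq[OF B] intro!: bexI[of _ "unit_vec nc j"])
    with sub have "col B j \<in> vec_space.col_space n A" ..
    thus ?thesis using A by (auto simp: vec_space.col_space_eq[OF A])
  qed
  then obtain y where y: "\<And>j. j < nc \<Longrightarrow> y j \<in> carrier_vec m" "\<And>j. j < nc \<Longrightarrow> A *\<^sub>v y j = col B j"
    by metis
  let ?Y = "mat m nc (\<lambda>(i, j). y j $ i)"
  have "col ?Y j = y j" if "j < nc" for j using y(1)[OF that] that by auto
  hence "B = A * ?Y"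
    using A B y(2) by (intro eq_matI) (metis carrier_matD col_def dim_col_mat(1) index_col index_mult_mat(1,2,3) index_mult_mat_vec, auto)
  thus thesis by (intro that[of ?Y]) auto
qed

section \<open>Matrix powers and left cancellation\<close>

lemma pow_mat_add:
  fixes A :: "'a::semiring_1 mat"
  assumes A: "A \<in> carrier_mat n n"
  shows "A ^\<^sub>m (a + b) = A ^\<^sub>m a * A ^\<^sub>m b"
proof (induction b)
  case (Suc b)
  thus ?case using A by (simp add: assoc_mult_mat[of _ n n _ n _ n])
qed (use A in auto)

lemma pow_mat_mult:
  fixes A :: "'a::semiring_1 mat"
  assumes A: "A \<in> carrier_mat n n"
  shows "A ^\<^sub>m (a * b) = (A ^\<^sub>m a) ^\<^sub>m b"
proof (induction b)
  case (Suc b)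
  thus ?case using pow_mat_add[OF A, of "a * b" a] by (simp add: add.commute)
qed (use A in auto)

lemma pow_mat_Suc_left:
  fixes A :: "'a::semiring_1 mat"
  assumes A: "A \<in> carrier_mat n n"
  shows "A ^\<^sub>m Suc k = A * A ^\<^sub>m k"
  using pow_mat_add[OF A, of 1 k] A by simp

lemma pow_mat_commute:
  fixes A :: "'a::semiring_1 mat"
  assumes A: "A \<in> carrier_mat n n" and B: "B \<in> carrier_mat n n" and com: "A * B = B * A"
  shows "A ^\<^sub>m k * B = B * A ^\<^sub>m k"
proof (induction k)
  case (Suc k)
  have "A ^\<^sub>m Suc k * B = A ^\<^sub>m k * B * A"
    using A B com by (simp add: assoc_mult_mat[of _ n n _ n _ n])
  thus ?case using Suc A B by (simp add: assoc_mult_mat[of _ n n _ n _ n])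
qed (use A B in auto)

text \<open>The columns of \<open>U - V\<close> lie in the kernel of \<open>A\<close>, hence in that
  of \<open>B\<close>. This replaces cancellation by an invertible matrix.\<close>

lemma mult_cancel_if_mat_kernel_subset:
  fixes A B U V :: "'a::comm_ring_1 mat"
  assumes A: "A \<in> carrier_mat nr n" and B: "B \<in> carrier_mat nr' n"
    and U: "U \<in> carrier_mat n nc" and V: "V \<in> carrier_mat n nc"
    and ker: "mat_kernel A \<subseteq> mat_kernel B" and eq: "A * U = A * V"
  shows "B * U = B * V"
proof (rule mat_col_eqI)
  fix j assume "j < dim_col (B * V)"
  hence j: "j < nc" using V by simp
  have carr: "col U j \<in> carrier_vec n" "col V j \<in> carrier_vec n" using U V by auto
  have "A *\<^sub>v col U j = A *\<^sub>v col V j"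
    using arg_cong[OF eq, of "\<lambda>M. col M j"] A U V j by (metis col_mult2)
  hence "A *\<^sub>v (col U j - col V j) = 0\<^sub>v nr"
    using A carr by (simp add: mult_minus_distrib_mat_vec)
  hence "col U j - col V j \<in> mat_kernel B"
    using ker carr by (auto intro!: mat_kernelI[OF A])
  hence "B *\<^sub>v (col U j - col V j) = 0\<^sub>v nr'" using mat_kernelD[OF B] by simp
  hence "B *\<^sub>v col U j - B *\<^sub>v col V j = 0\<^sub>v nr'"
    using B carr by (simp add: mult_minus_distrib_mat_vec)
  hence "B *\<^sub>v col U j = B *\<^sub>v col V j"
    using B carr by (intro eq_vecI) (auto dest: arg_cong[of _ _ "\<lambda>v. v $ _"] simp: vec_eq_iff)
  thus "col (B * U) j = col (B * V) j" by (simp only: col_mult2[OF B U j] col_mult2[OF B V j])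
qed (use B U V in auto)

subsection \<open>The Drazin inverse\<close>

text \<open>Commutation turns \<open>X * A * X = X\<close> into \<open>X * (X * A) = X\<close>,
  which can be substituted into itself. Thus \<open>X\<close> is a left and a right multiple of
  every power of \<open>A\<close>.\<close>

lemma is_drazin_inverse_pow:
  fixes A X :: "'a::field mat"
  assumes A: "A \<in> carrier_mat n n" and X: "is_drazin_inverse A X"
  shows "X ^\<^sub>m Suc m * A ^\<^sub>m m = X" and "A ^\<^sub>m m * X ^\<^sub>m Suc m = X"
proof -
  note assoc = assoc_mult_mat[of _ n n _ n _ n]
  have Xc: "X \<in> carrier_mat n n" and XAX: "X * A * X = X" and com: "A * X = X * A"
    using X A by (auto simp: is_drazin_inverse_def)
  have XXA: "X * (X * A) = X" using XAX com A Xc by (simp add: assoc)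
  show 1: "X ^\<^sub>m Suc m * A ^\<^sub>m m = X"
  proof (induction m)
    case (Suc m)
    have "X ^\<^sub>m Suc (Suc m) * A ^\<^sub>m Suc m = X ^\<^sub>m m * (X * (X * A)) * A ^\<^sub>m m"
      using A Xc unfolding pow_mat_Suc_left[OF A, of m] by (simp add: assoc)
    also have "\<dots> = X" using Suc unfolding XXA by simp
    finally show ?case .
  qed (use A Xc in auto)
  have "X ^\<^sub>m Suc m * A ^\<^sub>m m = A ^\<^sub>m m * X ^\<^sub>m Suc m"
    by (rule pow_mat_commute[OF Xc _ pow_mat_commute[OF A Xc com, symmetric]]) (use A in simp)
  with 1 show "A ^\<^sub>m m * X ^\<^sub>m Suc m = X" by simp
qed

text \<open>Both inverses equal \<open>X * A * X'\<close>: writing \<open>X = Y * P\<close> lets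
  \<open>P\<close> absorb \<open>A * X'\<close> on its right, and writing \<open>X' = P * Y'\<close>
  lets \<open>P\<close> absorb \<open>X * A\<close> on its left.\<close>

lemma is_drazin_inverse_unique:
  fixes A X X' :: "'a::field mat"
  assumes A: "A \<in> carrier_mat n n" and X: "is_drazin_inverse A X" and X': "is_drazin_inverse A X'"
  shows "X = X'"
proof -
  note assoc = assoc_mult_mat[of _ n n _ n _ n]
  let ?k = "mat_index A"
  define Y where "Y = X ^\<^sub>m Suc ?k"
  define Y' where "Y' = X' ^\<^sub>m Suc ?k"
  define P where "P = A ^\<^sub>m ?k"
  have c: "X \<in> carrier_mat n n" "X' \<in> carrier_mat n n" "P \<in> carrier_mat n n"
    using X X' A by (auto simp: is_drazin_inverse_def P_def)
  hence c': "Y \<in> carrier_mat n n" "Y' \<in> carrier_mat n n" by (simp_all add: Y_def Y'_def del: pow_mat.simps)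
  have eqs: "P * (A * X) = P" "P * (A * X') = P" and com: "A * X = X * A"
    using X X' A c by (auto simp: is_drazin_inverse_def P_def assoc)
  have YP: "Y * P = X" "P * Y' = X'"
    using is_drazin_inverse_pow[OF A X] is_drazin_inverse_pow[OF A X'] by (simp_all only: Y_def Y'_def P_def)
  have PX: "P * X = X * P" unfolding P_def by (rule pow_mat_commute[OF A c(1) com])
  have "A * P = P * A" unfolding P_def using pow_mat_Suc_left[OF A, of ?k] by simp
  hence "X * A * P = X * P * A" using assoc[OF c(1) A c(3)] assoc[OF c(1) c(3) A] by simp
  also have "\<dots> = P * (A * X)" using assoc[OF c(3) c(1) A] PX com by simp
  finally have XAP: "X * A * P = P" using eqs by simp
  have "X = Y * (P * (A * X'))" using YP eqs by simp
  also have "\<dots> = X * (A * X')" using YP(1) assoc[OF c'(1) c(3) mult_carrier_mat[OF A c(2)]] by simp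
  also have "\<dots> = X * A * P * Y'" using YP(2) A c c' by (simp add: assoc)
  also have "\<dots> = X'" using XAP YP by simp
  finally show ?thesis .
qed

section \<open>Stable powers and existence of the Drazin inverse\<close>

lemma mat_kernel_pow_mono:
  fixes A :: "'a::comm_ring_1 mat"
  assumes A: "A \<in> carrier_mat n n"
  shows "mat_kernel (A ^\<^sub>m k) \<subseteq> mat_kernel (A ^\<^sub>m (m + k))"
  using mat_kernel_mult_subset[of "A ^\<^sub>m k" n n "A ^\<^sub>m m" n] A pow_mat_add[OF A, of m k] by simp

text \<open>If \<open>A ^\<^sub>m (k + Suc m)\<close> kills \<open>v\<close>, then
  \<open>A ^\<^sub>m Suc k\<close> kills \<open>A ^\<^sub>m m *\<^sub>v v\<close>, and stability
  lowers that exponent to \<open>k\<close>.\<close>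

lemma mat_kernel_pow_stable:
  fixes A :: "'a::comm_ring_1 mat"
  assumes A: "A \<in> carrier_mat n n" and stab: "mat_kernel (A ^\<^sub>m Suc k) = mat_kernel (A ^\<^sub>m k)"
  shows "mat_kernel (A ^\<^sub>m (k + m)) = mat_kernel (A ^\<^sub>m k)"
proof (induction m)
  case (Suc m)
  have "v \<in> mat_kernel (A ^\<^sub>m (k + m))" if "v \<in> mat_kernel (A ^\<^sub>m (k + Suc m))" for v
  proof -
    have v: "v \<in> carrier_vec n" and 0: "A ^\<^sub>m (k + Suc m) *\<^sub>v v = 0\<^sub>v n"
      using mat_kernelD[OF pow_carrier_mat[OF A] that] by auto
    have "A ^\<^sub>m Suc k *\<^sub>v (A ^\<^sub>m m *\<^sub>v v) = 0\<^sub>v n"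
      using 0 A v pow_mat_add[OF A, of "Suc k" m]
      by (simp del: pow_mat.simps flip: assoc_mult_mat_vec[of _ n n _ n])
    hence "A ^\<^sub>m m *\<^sub>v v \<in> mat_kernel (A ^\<^sub>m Suc k)"
      by (intro mat_kernelI[OF pow_carrier_mat[OF A]] mult_mat_vec_carrier[OF pow_carrier_mat[OF A] v])
    hence "A ^\<^sub>m k *\<^sub>v (A ^\<^sub>m m *\<^sub>v v) = 0\<^sub>v n"
      unfolding stab using mat_kernelD[OF pow_carrier_mat[OF A]] by blast
    thus ?thesis
      using A v by (intro mat_kernelI[of _ n n]) (auto simp: pow_mat_add[OF A] assoc_mult_mat_vec[of _ n n _ n])
  qed
  moreover have "mat_kernel (A ^\<^sub>m (k + m)) \<subseteq> mat_kernel (A ^\<^sub>m (k + Suc m))"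
    using mat_kernel_pow_mono[OF A, of "k + m" 1] by simp
  ultimately show ?case using Suc by blast
qed simp

text \<open>Kernels grow and column spaces shrink along the powers; equal ranks turn both inclusions
  into equalities. Equality of the column spaces is used in the form of a right factor.\<close>

lemma rank_pow_stable:
  fixes A :: "'a::field mat"
  assumes A: "A \<in> carrier_mat n n" and rank: "mat_rank (A ^\<^sub>m Suc k) = mat_rank (A ^\<^sub>m k)"
  shows "mat_kernel (A ^\<^sub>m Suc k) = mat_kernel (A ^\<^sub>m k)"
    and "\<exists>Y\<in>carrier_mat n n. A ^\<^sub>m k = A ^\<^sub>m Suc k * Y"
proof -
  note c = pow_carrier_mat[OF A]
  have rank': "vec_space.rank n (A ^\<^sub>m Suc k) = vec_space.rank n (A ^\<^sub>m k)"
    using rank A unfolding mat_rank_def by (simp del: pow_mat.simps)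
  show "mat_kernel (A ^\<^sub>m Suc k) = mat_kernel (A ^\<^sub>m k)"
    using mat_kernel_eq_if_rank_eq[OF c c _ rank'[symmetric]] mat_kernel_pow_mono[OF A, of k 1] by simp
  have "vec_space.col_space n (A ^\<^sub>m Suc k) \<subseteq> vec_space.col_space n (A ^\<^sub>m k)"
    using col_space_mult_subset[OF c A] by simp
  from col_space_eq_if_rank_eq[OF c c this rank']
  show "\<exists>Y\<in>carrier_mat n n. A ^\<^sub>m k = A ^\<^sub>m Suc k * Y"
    by (metis mult_factor_if_col_space_subset[OF c c] order_refl)
qed

text \<open>The candidate is \<open>X = P * Z\<close> with \<open>N * X = P\<close>, where
  \<open>P\<close> and \<open>N\<close> are the powers of \<open>A\<close> with exponents
  \<open>k\<close> and \<open>Suc k\<close>. The other two identities hold after multiplication by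
  \<open>N\<close> on the left, and \<open>N\<close> can be cancelled because both sides begin with
  \<open>P\<close>.\<close>

lemma is_drazin_inverse_exists:
  fixes A :: "'a::field mat"
  assumes A: "A \<in> carrier_mat n n" and idx: "mat_index A = k"
    and rank: "mat_rank (A ^\<^sub>m Suc k) = mat_rank (A ^\<^sub>m k)"
  shows "\<exists>X. is_drazin_inverse A X"
proof -
  note assoc = assoc_mult_mat[of _ n n _ n _ n]
  note c = pow_carrier_mat[OF A]
  define P where "P = A ^\<^sub>m k"
  have P: "P \<in> carrier_mat n n" using c by (simp add: P_def)
  have PA: "P * A = A * P" using pow_mat_Suc_left[OF A, of k] by (simp add: P_def)
  note ker = rank_pow_stable(1)[OF A rank]
  from rank_pow_stable(2)[OF A rank] obtain Y where Y: "Y \<in> carrier_mat n n" "P = P * A * Y"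
    unfolding P_def by auto
  \<comment> \<open>Each substitution of \<open>P * A * Y\<close> for \<open>P\<close> yields one
    more factor \<open>A\<close>, which moves to the left because it commutes with
    \<open>P\<close>.\<close>
  have "\<exists>Z\<in>carrier_mat n n. P = A ^\<^sub>m m * P * Z" for m
  proof (induction m)
    case 0
    show ?case using P A by (intro bexI[of _ "1\<^sub>m n"]) auto
  next
    case (Suc m)
    then obtain Z where Z: "Z \<in> carrier_mat n n" "P = A ^\<^sub>m m * P * Z" by blast
    have "P = A ^\<^sub>m m * (P * A * Y) * Z" using Z Y by simp
    also have "\<dots> = A ^\<^sub>m Suc m * P * (Y * Z)" unfolding PA using P A Z Y c by (simp add: assoc)
    finally show ?case using Z Y by (intro bexI[of _ "Y * Z"]) auto
  qed
  then obtain Z where Z: "Z \<in> carrier_mat n n" "P = A ^\<^sub>m Suc k * P * Z" by blast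
  define X where "X = P * Z"
  have X: "X \<in> carrier_mat n n" using P Z by (simp add: X_def)
  define N where "N = A ^\<^sub>m Suc k"
  have N: "N \<in> carrier_mat n n" using c unfolding N_def by blast
  have NX: "N * X = P" using Z P N by (simp add: X_def N_def assoc del: pow_mat.simps)
  have NA: "N * A = A * N" unfolding N_def using pow_mat_Suc_left[OF A, of "Suc k"] by simp
  have N_PA: "N = P * A" by (simp add: N_def P_def)
  \<comment> \<open>\<open>N * P\<close> is the power of \<open>A\<close> with exponent
    \<open>2 * k + 1\<close>, so by stability its kernel is that of \<open>P\<close>.\<close>
  have cancel: "P * U = P * V" if "U \<in> carrier_mat n n" "V \<in> carrier_mat n n" "N * (P * U) = N * (P * V)" for U V
  proof (rule mult_cancel_if_mat_kernel_subset[OF mult_carrier_mat[OF N P] P that(1,2)])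
    show "mat_kernel (N * P) \<subseteq> mat_kernel P"
      using mat_kernel_pow_stable[OF A ker, of "Suc k"] pow_mat_add[OF A, of "Suc k" k]
      by (simp add: N_def P_def add.commute del: pow_mat.simps)
    show "N * P * U = N * P * V" using that N P by (simp add: assoc)
  qed
  have AX: "A * X = P * (A * Z)" using assoc[OF A P Z(1)] assoc[OF P A Z(1)] PA by (simp add: X_def)
  have com: "A * X = X * A"
  proof -
    \<comment> \<open>Since \<open>N\<close> commutes with \<open>A\<close> and
      \<open>N * X = P\<close>, both sides equal \<open>A * P\<close>.\<close>
    have "N * (A * X) = N * (X * A)"
    proof -
      have "N * (A * X) = A * N * X" unfolding NA[symmetric] by (rule assoc[OF N A X, symmetric])
      also have "\<dots> = A * P" using assoc[OF A N X] NX by simp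
      also have "\<dots> = N * X * A" using NX PA by simp
      also have "\<dots> = N * (X * A)" by (rule assoc[OF N X A])
      finally show ?thesis .
    qed
    hence "P * (A * Z) = P * (Z * A)"
      using A P Z AX by (intro cancel) (auto simp: X_def assoc)
    thus ?thesis using AX A P Z by (simp add: X_def assoc)
  qed
  have "X * A * X = X"
  proof -
    have "N * (X * A * X) = N * X"
    proof -
      have "N * (X * A * X) = N * X * A * X" using N X A by (simp add: assoc)
      also have "\<dots> = N * X" using NX N_PA by simp
      finally show ?thesis .
    qed
    hence "P * (Z * A * X) = P * Z"
      using A P Z X by (intro cancel) (auto simp: X_def assoc)
    thus ?thesis using A P Z X by (simp add: X_def assoc)
  qed
  hence "is_drazin_inverse A X"
    using A X com NX idx unfolding is_drazin_inverse_def by (simp add: N_def P_def)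
  thus ?thesis ..
qed

lemma is_drazin_inverse_drazin_inverse:
  fixes A :: "'a::field mat"
  assumes A: "A \<in> carrier_mat n n" and idx: "mat_index A = k"
    and rank: "mat_rank (A ^\<^sub>m Suc k) = mat_rank (A ^\<^sub>m k)"
  shows "is_drazin_inverse A (drazin_inverse A)"
proof -
  from is_drazin_inverse_exists[OF assms] have "\<exists>!X. is_drazin_inverse A X"
    using is_drazin_inverse_unique[OF A] by blast
  thus ?thesis unfolding drazin_inverse_def by (rule theI')
qed

subsection \<open>Coefficients of the adjugate\<close>

text \<open>The sign change presents \<lambda>I + M as a characteristic matrix, so its determinant
  is \<open>char_poly (- M)\<close>.\<close>

lemma char_poly_matrix_uminus:
  assumes "M \<in> carrier_mat n n"
  shows "char_poly_matrix (- M) = mat n n (\<lambda>(a, b). [:M $$ (a, b):] + (if a = b then [:0, 1:] else 0))"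
  using assms by (intro eq_matI) (auto simp: char_poly_matrix_def)

lemma coeff_char_poly_uminus:
  assumes M: "M \<in> carrier_mat n n" and r: "r \<le> n"
  shows "coeff (char_poly (- M)) (n - r) = (\<Sum>\<alpha>\<in>index_sets r n. principal_minor M \<alpha>)"
  using coeff_det_add_var_diag[OF M r, of UNIV]
  by (simp add: char_poly_def char_poly_matrix_uminus[OF M] cong: if_cong)

text \<open>The adjugate of \<open>\<lambda>I + M\<close> is \<open>\<Sum>\<^sub>s \<lambda>\<^sup>s \<cdot> adj_coeff M s\<close>.\<close>

definition adj_coeff :: "'a::comm_ring_1 mat \<Rightarrow> nat \<Rightarrow> 'a mat" where
  "adj_coeff M s = map_mat (\<lambda>p. coeff p s) (adj_mat (char_poly_matrix (- M)))"

lemma adj_coeff_carrier [simp]: "M \<in> carrier_mat n n \<Longrightarrow> adj_coeff M s \<in> carrier_mat n n"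
  using adj_mat(1)[OF char_poly_matrix_closed[of "- M" n]] by (simp add: adj_coeff_def)

text \<open>Leaving row \<open>j\<close> without the variable forces \<open>j\<close> into \<alpha>.
  Laplace expansion along that row has coefficients \<open>b\<close> and the cofactors of \<lambda>I
  + M, which form column \<open>j\<close> of the adjugate.\<close>

lemma sum_principal_minor_replace_row:
  assumes M: "M \<in> carrier_mat n n" and r: "r \<le> n" and j: "j < n" and b: "b \<in> carrier_vec n"
  shows "(\<Sum>\<alpha>\<in>index_sets_at r n j. principal_minor (replace_row M j b) \<alpha>) =
    (\<Sum>l<n. b $ l * adj_coeff M (n - r) $$ (l, j))"
proof -
  let ?R = "replace_row M j b"
  let ?L = "char_poly_matrix (- M)"
  let ?D = "mat n n (\<lambda>(a, c). [:?R $$ (a, c):] + (if a = c then if a \<in> - {j} then [:0, 1:] else 0 else 0))"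
  have R: "?R \<in> carrier_mat n n" using M by (simp add: replace_row_def)
  have "index_sets_at r n j = {\<alpha>. \<alpha> \<in> index_sets r n \<and> {..<n} - - {j} \<subseteq> \<alpha>}"
    using j by (auto simp: index_sets_at_def)
  hence "(\<Sum>\<alpha>\<in>index_sets_at r n j. principal_minor ?R \<alpha>) = coeff (det ?D) (n - r)"
    using coeff_det_add_var_diag[OF R r, of "- {j}"] by simp
  also have "det ?D = (\<Sum>l<n. ?D $$ (j, l) * cofactor ?D j l)"
    by (rule laplace_expansion_row) (use j in auto)
  also have "\<dots> = (\<Sum>l<n. smult (b $ l) (adj_mat ?L $$ (l, j)))"
  proof (rule sum.cong[OF refl])
    fix l assume l: "l \<in> {..<n}"
    \<comment> \<open>The two matrices differ only in row \<open>j\<close>, which is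
      deleted.\<close>
    have "mat_delete ?D j l = mat_delete ?L j l"
      unfolding char_poly_matrix_uminus[OF M] using j l M
      by (intro eq_matI) (auto simp: mat_delete_def replace_row_def)
    hence "cofactor ?D j l = adj_mat ?L $$ (l, j)"
      using j l M by (simp add: cofactor_def adj_mat_def char_poly_matrix_uminus)
    moreover have "?D $$ (j, l) = [:b $ l:]" using j l M by (simp add: replace_row_def)
    ultimately show "?D $$ (j, l) * cofactor ?D j l = smult (b $ l) (adj_mat ?L $$ (l, j))" by simp
  qed
  finally show ?thesis
    using M j adj_mat(1)[OF char_poly_matrix_closed[of "- M" n]] by (simp add: coeff_sum adj_coeff_def)
qed

lemma adj_coeff_rec:
  assumes M: "M \<in> carrier_mat n n"
  shows "M * adj_coeff M 0 = coeff (char_poly (- M)) 0 \<cdot>\<^sub>m 1\<^sub>m n"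
    and "adj_coeff M s + M * adj_coeff M (Suc s) = coeff (char_poly (- M)) (Suc s) \<cdot>\<^sub>m 1\<^sub>m n"
proof -
  let ?L = "char_poly_matrix (- M)"
  let ?B = "adj_mat ?L"
  have L: "?L \<in> carrier_mat n n" using M by simp
  note B = adj_mat(1)[OF L]
  \<comment> \<open>This is entry \<open>(i, j)\<close> of (\<lambda>I + M) adj(\<lambda>I + M) =
    det(\<lambda>I + M) I, with \<open>pCons 0\<close> as multiplication by \<lambda>. Its constant
    coefficient and its coefficient at \<open>Suc s\<close> give the two claims.\<close>
  have ent: "pCons 0 (?B $$ (i, j)) + (\<Sum>l<n. smult (M $$ (i, l)) (?B $$ (l, j))) =
      (if i = j then char_poly (- M) else 0)" if ij: "i < n" "j < n" for i j
  proof -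
    have "(if i = j then char_poly (- M) else 0) = (?L * ?B) $$ (i, j)"
      using adj_mat(2)[OF L] ij by (simp add: char_poly_def)
    also have "\<dots> = (\<Sum>l<n. ?L $$ (i, l) * ?B $$ (l, j))"
      using L B ij by (simp add: scalar_prod_def atLeast0LessThan)
    also have "\<dots> = (\<Sum>l<n. (if i = l then pCons 0 (?B $$ (l, j)) else 0) + smult (M $$ (i, l)) (?B $$ (l, j)))"
      using M ij by (intro sum.cong refl) (auto simp: char_poly_matrix_uminus)
    also have "\<dots> = pCons 0 (?B $$ (i, j)) + (\<Sum>l<n. smult (M $$ (i, l)) (?B $$ (l, j)))"
      using ij by (simp add: sum.distrib)
    finally show ?thesis by simp
  qed
  have mult: "(M * adj_coeff M s) $$ (i, j) = (\<Sum>l<n. M $$ (i, l) * coeff (?B $$ (l, j)) s)"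
    if "i < n" "j < n" for i j s
    using M B that by (simp add: adj_coeff_def scalar_prod_def atLeast0LessThan)
  note [simp del] = index_mult_mat(1)
  show "M * adj_coeff M 0 = coeff (char_poly (- M)) 0 \<cdot>\<^sub>m 1\<^sub>m n"
  proof (rule eq_matI)
    fix i j assume "i < dim_row (coeff (char_poly (- M)) 0 \<cdot>\<^sub>m 1\<^sub>m n)" "j < dim_col (coeff (char_poly (- M)) 0 \<cdot>\<^sub>m 1\<^sub>m n)"
    hence ij: "i < n" "j < n" by auto
    show "(M * adj_coeff M 0) $$ (i, j) = (coeff (char_poly (- M)) 0 \<cdot>\<^sub>m 1\<^sub>m n) $$ (i, j)"
      using arg_cong[OF ent[OF ij], of "\<lambda>p. coeff p 0"] ij by (simp add: mult coeff_sum split: if_splits)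
  qed (use M B in \<open>auto simp: adj_coeff_def\<close>)
  show "adj_coeff M s + M * adj_coeff M (Suc s) = coeff (char_poly (- M)) (Suc s) \<cdot>\<^sub>m 1\<^sub>m n"
  proof (rule eq_matI)
    fix i j assume "i < dim_row (coeff (char_poly (- M)) (Suc s) \<cdot>\<^sub>m 1\<^sub>m n)" "j < dim_col (coeff (char_poly (- M)) (Suc s) \<cdot>\<^sub>m 1\<^sub>m n)"
    hence ij: "i < n" "j < n" by auto
    have "adj_coeff M s $$ (i, j) = coeff (?B $$ (i, j)) s" using B ij by (simp add: adj_coeff_def)
    thus "(adj_coeff M s + M * adj_coeff M (Suc s)) $$ (i, j) = (coeff (char_poly (- M)) (Suc s) \<cdot>\<^sub>m 1\<^sub>m n) $$ (i, j)"
      using arg_cong[OF ent[OF ij], of "\<lambda>p. coeff p (Suc s)"] ij carrier_matD[OF M]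
        carrier_matD[OF adj_coeff_carrier[OF M]]
      by (simp add: mult coeff_sum split: if_splits)
  qed (use M B in \<open>auto simp: adj_coeff_def\<close>)
qed

text \<open>Where the coefficient vanishes, the recurrence expresses
  \<open>M * adj_coeff M (Suc s)\<close> as the negative of \<open>adj_coeff M s\<close>, which
  \<open>M ^\<^sub>m Suc s\<close> kills by induction.\<close>

lemma pow_mult_adj_coeff_eq_0:
  fixes M :: "'a::comm_ring_1 mat"
  assumes M: "M \<in> carrier_mat n n" and low: "\<And>t. t \<le> s \<Longrightarrow> coeff (char_poly (- M)) t = 0"
  shows "M ^\<^sub>m Suc s * adj_coeff M s = 0\<^sub>m n n"
proof -
  have zero: "(0::'a) \<cdot>\<^sub>m 1\<^sub>m n = 0\<^sub>m n n" by (intro eq_matI) auto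
  show ?thesis
    using low
  proof (induction s)
    case 0
    thus ?case using adj_coeff_rec(1)[OF M] M by (simp add: zero)
  next
    case (Suc s)
    let ?P = "M ^\<^sub>m Suc s"
    have P: "?P \<in> carrier_mat n n" using pow_carrier_mat[OF M] .
    note B = adj_coeff_carrier[OF M]
    have "0\<^sub>m n n = ?P * (adj_coeff M s + M * adj_coeff M (Suc s))"
      using adj_coeff_rec(2)[OF M, of s] Suc.prems[of "Suc s"] P by (simp add: zero right_mult_zero_mat[of _ n n] del: pow_mat.simps)
    also have "\<dots> = ?P * adj_coeff M s + ?P * (M * adj_coeff M (Suc s))"
      by (rule mult_add_distrib_mat[OF P B mult_carrier_mat[OF M B]])
    also have "?P * adj_coeff M s = 0\<^sub>m n n" using Suc by simp
    also have "?P * (M * adj_coeff M (Suc s)) = M ^\<^sub>m Suc (Suc s) * adj_coeff M (Suc s)"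
      using assoc_mult_mat[OF P M B, of "Suc s"] by simp
    finally show ?case using mult_carrier_mat[OF pow_carrier_mat[OF M] B] by (simp del: pow_mat.simps)
  qed
qed

text \<open>The multiplicity of 0 is the total size of the Jordan blocks for 0, that is, the kernel
  dimension of a high power of \<open>M\<close>; by \<open>stab\<close> this is already that of
  \<open>M\<close>.\<close>

lemma order_0_char_poly:
  fixes M :: "complex mat"
  assumes M: "M \<in> carrier_mat n n"
    and stab: "\<And>m. mat_kernel (M ^\<^sub>m Suc m) = mat_kernel M"
  shows "order 0 (char_poly M) = kernel_dim M"
proof -
  obtain as where "char_poly M = (\<Prod>a\<leftarrow>as. [:- a, 1:])"
    using char_poly_factorized[OF M] by blast
  then obtain n_as where jnf: "jordan_nf M n_as" using jordan_nf_exists[OF M] by blast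
  let ?ns = "map fst [(n, e)\<leftarrow>n_as. e = 0]"
  \<comment> \<open>This exponent exceeds every block size, so each minimum with it is the block
    size itself; being a successor, it also fits \<open>stab\<close>.\<close>
  let ?m = "Suc (sum_list ?ns)"
  have M0: "char_matrix M 0 = M" using M by (intro eq_matI) (auto simp: char_matrix_def)
  have "order 0 (char_poly M) = sum_list ?ns"
    unfolding jordan_nf_order[OF jnf] by (simp add: case_prod_unfold)
  also have "\<dots> = (\<Sum>n\<leftarrow>?ns. min ?m n)"
    using member_le_sum_list[of _ ?ns] by (intro arg_cong[of _ _ sum_list] map_idI[symmetric]) fastforce
  also have "\<dots> = kernel_dim (M ^\<^sub>m ?m)"
    using dim_gen_eigenspace[OF jnf, of 0 ?m] by (simp add: dim_gen_eigenspace_def M0)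
  also have "\<dots> = kernel_dim M"
    using stab M by (simp add: kernel_dim_def del: pow_mat.simps)
  finally show ?thesis .
qed

subsection \<open>The determinantal representation\<close>

theorem theorem2p5:
  fixes A :: "complex mat" and n k r :: nat
  assumes "A \<in> carrier_mat n n"
    and "mat_index A = k"
    and "mat_rank (A ^\<^sub>m (k + 1)) = r"
    and "mat_rank (A ^\<^sub>m k) = r"
    and "1 \<le> r" and "r \<le> n"
  shows "\<forall>i<n. \<forall>j<n.
    drazin_inverse A $$ (i, j) =
      (\<Sum>\<alpha>\<in>index_sets_at r n j.
         principal_minor (replace_row (A ^\<^sub>m (k + 1)) j (row (A ^\<^sub>m k) i)) \<alpha>)
      / (\<Sum>\<alpha>\<in>index_sets r n. principal_minor (A ^\<^sub>m (k + 1)) \<alpha>)"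
proof -
  note A = assms(1)
  note assoc = assoc_mult_mat[of _ n n _ n _ n]
  define M where "M = A ^\<^sub>m Suc k"
  define P where "P = A ^\<^sub>m k"
  define X where "X = drazin_inverse A"
  let ?c = "coeff (char_poly (- M))"
  have M: "M \<in> carrier_mat n n" and P: "P \<in> carrier_mat n n"
    using pow_carrier_mat[OF A] unfolding M_def P_def by blast+
  have rank: "mat_rank (A ^\<^sub>m Suc k) = mat_rank (A ^\<^sub>m k)" using assms(3,4) by simp
  have drazin: "is_drazin_inverse A X"
    unfolding X_def by (rule is_drazin_inverse_drazin_inverse[OF A assms(2) rank])
  hence X: "X \<in> carrier_mat n n" and MX: "M * X = P" and com: "A * X = X * A"
    using A assms(2) by (auto simp: is_drazin_inverse_def M_def P_def)
  have XM: "X * M = P" using MX pow_mat_commute[OF A X com, of "Suc k"] by (simp only: M_def)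
  note ker = rank_pow_stable(1)[OF A rank]
  have stab: "mat_kernel (M ^\<^sub>m Suc m) = mat_kernel M" for m
  proof -
    \<comment> \<open>As a power of \<open>A\<close> the exponent is at least \<open>k\<close>,
      where the kernels are stable.\<close>
    have e: "M ^\<^sub>m Suc m = A ^\<^sub>m (k + (1 + Suc k * m))"
      using pow_mat_mult[OF A, of "Suc k" "Suc m"] by (simp add: M_def del: pow_mat.simps)
    show ?thesis unfolding e unfolding M_def by (rule trans[OF mat_kernel_pow_stable[OF A ker] ker[symmetric]])
  qed
  have "kernel_dim M = n - r"
    using rank_add_kernel_dim[OF M] assms(3) carrier_matD[OF A] by (simp add: mat_rank_def M_def)
  moreover have "order 0 (char_poly (- M)) = order 0 (char_poly M)"
  proof -
    have "- M = (- 1) \<cdot>\<^sub>m M" by (intro eq_matI) auto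
    thus ?thesis using order_char_poly_smult[OF M, of "- 1" 0] by simp
  qed
  ultimately have ord: "order 0 (char_poly (- M)) = n - r"
    using order_0_char_poly[OF M stab] by simp
  have "char_poly (- M) \<noteq> 0"
    using degree_monic_char_poly[of "- M" n] M by auto
  \<comment> \<open>Both sides say that \<lambda>^m divides the polynomial. Taking
    \<open>m = n - r\<close> gives the vanishing coefficients, and the next \<open>m\<close> the
    nonzero one.\<close>
  hence dvd: "(\<forall>t<m. ?c t = 0) \<longleftrightarrow> m \<le> n - r" for m
    using monom_1_dvd_iff[of "char_poly (- M)" m] monom_1_dvd_iff'[of m "char_poly (- M)"] ord by simp
  have low: "?c t = 0" if "t < n - r" for t using dvd[of "n - r"] that by simp
  have nz: "?c (n - r) \<noteq> 0"
    using dvd[of "Suc (n - r)"] low by (auto simp: less_Suc_eq)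
  note B = adj_coeff_carrier[OF M]
  have Xone: "X * (c \<cdot>\<^sub>m 1\<^sub>m n) = c \<cdot>\<^sub>m X" for c
    using mult_smult_distrib[OF X one_carrier_mat, of c] X by simp
  have PB: "P * adj_coeff M (n - r) = ?c (n - r) \<cdot>\<^sub>m X"
  \<comment> \<open>The coefficient preceding \<open>adj_coeff M (n - r)\<close> exists only for
    \<open>n - r > 0\<close>; otherwise the constant-term equation suffices.\<close>
  proof (cases "n - r")
    case 0
    have "P * adj_coeff M 0 = X * (M * adj_coeff M 0)" using assoc[OF X M B] XM by simp
    thus ?thesis using 0 adj_coeff_rec(1)[OF M] Xone by simp
  next
    case (Suc s)
    \<comment> \<open>The exponent is chosen so that the power of \<open>A\<close> on the right is
      exactly \<open>M ^\<^sub>m Suc s\<close>, which annihilates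
      \<open>adj_coeff M s\<close>.\<close>
    have "X = X ^\<^sub>m Suc (Suc k * Suc s) * M ^\<^sub>m Suc s"
      using is_drazin_inverse_pow(1)[OF A drazin, of "Suc k * Suc s"] pow_mat_mult[OF A, of "Suc k" "Suc s"]
      by (simp only: M_def)
    hence "X * adj_coeff M s = X ^\<^sub>m Suc (Suc k * Suc s) * (M ^\<^sub>m Suc s * adj_coeff M s)"
      using assoc[OF pow_carrier_mat[OF X] pow_carrier_mat[OF M] B] by metis
    also have "\<dots> = 0\<^sub>m n n"
      using pow_mult_adj_coeff_eq_0[OF M, of s] low Suc
      by (simp add: right_mult_zero_mat[OF pow_carrier_mat[OF X]] del: pow_mat.simps)
    finally have XB: "X * adj_coeff M s = 0\<^sub>m n n" .
    have "?c (Suc s) \<cdot>\<^sub>m X = X * (adj_coeff M s + M * adj_coeff M (Suc s))"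
      using adj_coeff_rec(2)[OF M, of s] Xone by simp
    also have "\<dots> = X * adj_coeff M s + X * (M * adj_coeff M (Suc s))"
      by (rule mult_add_distrib_mat[OF X B mult_carrier_mat[OF M B]])
    also have "X * (M * adj_coeff M (Suc s)) = P * adj_coeff M (Suc s)"
      using assoc[OF X M B] XM by simp
    finally show ?thesis using Suc XB mult_carrier_mat[OF P B] by simp
  qed
  show ?thesis
  proof (intro allI impI)
    fix i j assume ij: "i < n" "j < n"
    have "(\<Sum>\<alpha>\<in>index_sets_at r n j. principal_minor (replace_row M j (row P i)) \<alpha>) =
        (\<Sum>l<n. row P i $ l * adj_coeff M (n - r) $$ (l, j))"
      using P by (intro sum_principal_minor_replace_row[OF M assms(6) ij(2)]) auto
    also have "\<dots> = (P * adj_coeff M (n - r)) $$ (i, j)"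
      using P B[of "n - r"] ij by (simp add: scalar_prod_def atLeast0LessThan)
    \<comment> \<open>The factor \<open>?c (n - r)\<close> is the denominator and is nonzero by
      \<open>nz\<close>, so division isolates the entry of \<open>X\<close>.\<close>
    also have "\<dots> = ?c (n - r) * X $$ (i, j)" using PB X ij by simp
    finally show "drazin_inverse A $$ (i, j) =
      (\<Sum>\<alpha>\<in>index_sets_at r n j.
         principal_minor (replace_row (A ^\<^sub>m (k + 1)) j (row (A ^\<^sub>m k) i)) \<alpha>)
      / (\<Sum>\<alpha>\<in>index_sets r n. principal_minor (A ^\<^sub>m (k + 1)) \<alpha>)"
      using nz coeff_char_poly_uminus[OF M assms(6)]
      by (simp add: X_def M_def P_def del: pow_mat.simps)
  qed
qed

end
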